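(* Let $T>a>0$. With $\tau$ denoting a generic $(\mathcal{F}_t)$-stopping time, $$v(a) \equiv \sup_{a \leq \tau \leq T+a} E[\, S_{\tau-a}\,] = \sup_{0 \leq \tau \leq T} E[\, Z_\tau\,],$$ where $Z_t \equiv \sup\{ S_u : t-a \leq u \leq t\}$. Here the first supremum is over all $(\mathcal{F}_t)$-stopping times $\tau$ with $a\le\tau\le T+a$, and the second is over all $(\mathcal{F}_t)$-stopping times $\tau$ with $0\le\tau\le T$.
   Context: $W=(W_t)_{t\ge0}$ is a standard Brownian motion, namely the canonical process on $C(\mathbb{R}^+,\mathbb{R})$ under Wiener measure $P$; $E$ denotes expectation under $P$, and $(\mathcal{F}_t)$ is the usual $P$-augmentation of the canonical filtration of $W$. The constants $T>a>0$ are fixed. The (discounted, standardized) stock price process $S$ is defined by $$S_t = \exp\left(W_t - \tfrac12 t\right)\quad (0\le t\le T),\qquad S_t = S_T \quad (t\ge T),\qquad S_t = 1\quad (t<0).$$ *)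

theory Defs
  imports "HOL-Probability.Probability"
begin

section \<open>Brownian motion and the canonical path space\<close>

definition standard_brownian_motion :: "'a measure \<Rightarrow> (real \<Rightarrow> 'a \<Rightarrow> real) \<Rightarrow> bool" where
  "standard_brownian_motion M W \<longleftrightarrow>
     prob_space M \<and>
     (\<forall>t\<ge>0. W t \<in> borel_measurable M) \<and>
     (AE \<omega> in M. W 0 \<omega> = 0) \<and>
     (\<forall>s t. 0 \<le> s \<and> s < t \<longrightarrow>
        distributed M lborel (\<lambda>\<omega>. W t \<omega> - W s \<omega>) (normal_density 0 (sqrt (t - s)))) \<and>
     (\<forall>(n::nat) t::nat \<Rightarrow> real. 0 \<le> t 0 \<and> strict_mono t \<longrightarrow>
        prob_space.indep_vars M (\<lambda>_. borel) (\<lambda>i \<omega>. W (t (Suc i)) \<omega> - W (t i) \<omega>) {..<n}) \<and>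
     (\<forall>\<omega>\<in>space M. continuous_on {0..} (\<lambda>t. W t \<omega>))"

text \<open>
  The space of real-valued continuous functions on the nonnegative half-line, with the
  sigma-algebra generated by the coordinate maps. Since the space of \<open>PiM\<close> consists of extensional
  functions, a path is determined by its values at nonnegative times.
\<close>

definition path_space :: "(real \<Rightarrow> real) measure" where
  "path_space = restrict_space (PiM {0..} (\<lambda>_. borel)) {\<omega>. continuous_on {0..} \<omega>}"

definition wiener_measure :: "(real \<Rightarrow> real) measure \<Rightarrow> bool" where
  "wiener_measure P \<longleftrightarrow>
     sets P = sets path_space \<and> standard_brownian_motion P (\<lambda>t \<omega>. \<omega> t)"

section \<open>The usual augmentation of the canonical filtration\<close>

text \<open>
  The index type is all of \<open>real\<close>. At a negative time no coordinate is observed, so both filtrations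
  below contain only trivial information there; a nonnegative random time satisfies the
  stopping-time condition at negative times vacuously.
\<close>

definition canonical_filtration :: "real \<Rightarrow> (real \<Rightarrow> real) measure" where
  "canonical_filtration t = sigma (space path_space)
     {(\<lambda>\<omega>. \<omega> s) -` A \<inter> space path_space | s A. 0 \<le> s \<and> s \<le> t \<and> A \<in> sets borel}"

text \<open>
  Adjoin the null sets of the completed measure and make the result right-continuous.
  The intersection is itself a sigma-algebra; the outer \<open>sigma\<close> only packages it as a
  measurable space.
\<close>

definition augmented_filtration :: "(real \<Rightarrow> real) measure \<Rightarrow> real \<Rightarrow> (real \<Rightarrow> real) measure" where
  "augmented_filtration P t = sigma (space P)
     (\<Inter>s\<in>{t<..}. sigma_sets (space P)
        (sets (canonical_filtration s) \<union> null_sets (completion P)))"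

lemma sets_augmented_filtration:
  assumes "wiener_measure P"
  shows "sets (augmented_filtration P t) =
    (\<Inter>s\<in>{t<..}. sigma_sets (space P)
        (sets (canonical_filtration s) \<union> null_sets (completion P)))"
proof -
  let ?G = "\<lambda>s. sets (canonical_filtration s) \<union> null_sets (completion P)"
  have sp: "space P = space path_space"
    using assms by (auto simp: wiener_measure_def dest: sets_eq_imp_space_eq)
  have "sets (canonical_filtration s) \<subseteq> Pow (space P)" for s
    using sets.space_closed[of "canonical_filtration s"]
    by (simp add: canonical_filtration_def sp space_measure_of_conv)
  moreover have "null_sets (completion P) \<subseteq> Pow (space P)"
    using sets.space_closed[of "completion P"] by (auto simp: null_sets_def)
  ultimately have G: "?G s \<subseteq> Pow (space P)" for s by blast
  have "sigma_algebra (space P) (\<Inter>s\<in>{t<..}. sigma_sets (space P) (?G s))"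
    unfolding sigma_algebra_iff2
  proof (intro conjI ballI allI impI)
    show "(\<Inter>s\<in>{t<..}. sigma_sets (space P) (?G s)) \<subseteq> Pow (space P)"
      using sigma_sets_into_sp[OF G[of "t + 1"]] by (force dest: bspec[of _ _ "t + 1"])
  qed (auto intro: sigma_sets.intros)
  then show ?thesis
    unfolding augmented_filtration_def by (rule sigma_algebra.sets_measure_of_eq)
qed

lemma filtration_augmented:
  assumes "wiener_measure P"
  shows "filtration (space P) (augmented_filtration P)"
proof
  show "space (augmented_filtration P t) = space P" for t
    by (simp add: augmented_filtration_def space_measure_of_conv)
  show "sets (augmented_filtration P s) \<subseteq> sets (augmented_filtration P t)" if "s \<le> t" for s t
    using that by (auto simp: sets_augmented_filtration[OF assms])
qed

definition stopping_times_between ::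
    "(real \<Rightarrow> real) measure \<Rightarrow> real \<Rightarrow> real \<Rightarrow> ((real \<Rightarrow> real) \<Rightarrow> real) set" where
  "stopping_times_between P l u =
     {\<tau>. stopping_time (augmented_filtration P) \<tau> \<and> (\<forall>\<omega>\<in>space P. l \<le> \<tau> \<omega> \<and> \<tau> \<omega> \<le> u)}"

section \<open>The stock price and the optimal stopping value\<close>

definition stock_price :: "real \<Rightarrow> real \<Rightarrow> (real \<Rightarrow> real) \<Rightarrow> real" where
  "stock_price T t \<omega> =
     (if t < 0 then 1
      else if t \<le> T then exp (\<omega> t - t / 2)
      else exp (\<omega> T - T / 2))"

definition window_sup :: "real \<Rightarrow> real \<Rightarrow> real \<Rightarrow> (real \<Rightarrow> real) \<Rightarrow> real" where
  "window_sup T a t \<omega> = (SUP u\<in>{t - a..t}. stock_price T u \<omega>)"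

text \<open>
  Expectations of the nonnegative payoffs are taken in the extended nonnegative reals, so that
  suprema over stopping times need no boundedness or integrability side condition. They are taken
  under the completion because stopping times of the augmented filtration need not be measurable
  with respect to the uncompleted sigma-algebra.
\<close>

definition insider_value :: "(real \<Rightarrow> real) measure \<Rightarrow> real \<Rightarrow> real \<Rightarrow> ennreal" where
  "insider_value P T a =
     (SUP \<tau>\<in>stopping_times_between P a (T + a).
        \<integral>\<^sup>+ \<omega>. ennreal (stock_price T (\<tau> \<omega> - a) \<omega>) \<partial>completion P)"

end

theory Submission
  imports Defs
begin

text \<open>
  For one inequality, replace \<open>\<tau>\<close> by \<open>min \<tau> T\<close>: the time \<open>\<tau> - a\<close> lies in its window.
  For the other, let \<open>\<sigma>\<close> be the first time at which \<open>S\<close> attains its maximum over the nonnegative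
  part of the window that ends at \<open>\<tau>\<close>. Since \<open>\<sigma> + a \<ge> \<tau>\<close>, deciding whether \<open>\<sigma> \<le> t - a\<close>
  only requires \<open>\<tau>\<close> and the path up to time \<open>t\<close>, so \<open>\<sigma> + a\<close> is a stopping time whose payoff
  is \<open>Z\<^sub>\<tau>\<close> almost surely.
\<close>

section \<open>First maximizers over fixed and random windows\<close>

definition first_argmax :: "(real \<Rightarrow> real) \<Rightarrow> real \<Rightarrow> real \<Rightarrow> real" where
  "first_argmax f l m = Inf {u \<in> {l..m}. \<forall>v\<in>{l..m}. f v \<le> f u}"

text \<open>By compactness the set of maximizers is nonempty and closed, so it contains its infimum.
  The strict inequality to the left of that infimum is what will leave room for a separating
  rational level.\<close>

lemma first_argmax:
  fixes f :: "real \<Rightarrow> real"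
  assumes cont: "continuous_on {l..m} f" and "l \<le> m"
  shows "first_argmax f l m \<in> {l..m}"
    and "\<And>v. v \<in> {l..m} \<Longrightarrow> f v \<le> f (first_argmax f l m)"
    and "\<And>v. v \<in> {l..m} \<Longrightarrow> v < first_argmax f l m \<Longrightarrow> f v < f (first_argmax f l m)"
proof -
  let ?A = "{u \<in> {l..m}. \<forall>v\<in>{l..m}. f v \<le> f u}"
  obtain w where w: "w \<in> {l..m}" "\<And>v. v \<in> {l..m} \<Longrightarrow> f v \<le> f w"
    using continuous_attains_sup[OF _ _ cont] \<open>l \<le> m\<close> by auto
  \<comment> \<open>As a superlevel set at the attained maximum, \<open>?A\<close> is closed by
    continuity alone.\<close>
  have A: "?A = {u \<in> {l..m}. f w \<le> f u}"
    using w by (meson order_trans)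
  have "closed ?A"
    unfolding A by (rule continuous_on_closed_Collect_le[OF continuous_on_const cont]) simp
  moreover have "bdd_below ?A"
    by (auto intro: bdd_belowI[of _ l])
  ultimately have mem: "first_argmax f l m \<in> ?A"
    unfolding first_argmax_def using w by (intro closed_contains_Inf) auto
  then show "first_argmax f l m \<in> {l..m}"
    and max: "\<And>v. v \<in> {l..m} \<Longrightarrow> f v \<le> f (first_argmax f l m)"
    by auto
  fix v assume v: "v \<in> {l..m}" "v < first_argmax f l m"
  have "v \<notin> ?A"
  proof
    assume "v \<in> ?A"
    then have "first_argmax f l m \<le> v"
      unfolding first_argmax_def using \<open>bdd_below ?A\<close> by (rule cInf_lower)
    with v(2) show False by simp
  qed
  with v(1) obtain u where "u \<in> {l..m}" "f v < f u"
    by (auto simp: not_le)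
  with max[of u] show "f v < f (first_argmax f l m)"
    by linarith
qed

text \<open>The strict inequality persists near \<open>z\<close>, and this neighbourhood meets the
  open interval even if \<open>z\<close> is an endpoint, the case used below.\<close>

lemma continuous_on_greater_at_rat:
  fixes f :: "real \<Rightarrow> real"
  assumes "continuous_on {x..y} f" "z \<in> {x..y}" "x < y" "c < f z"
  obtains q :: rat where "x < of_rat q" "of_rat q < y" "c < f (of_rat q)"
proof -
  obtain d where d: "d > 0" "\<And>w. w \<in> {x..y} \<Longrightarrow> dist w z < d \<Longrightarrow> dist (f w) (f z) < f z - c"
    using assms(1)[unfolded continuous_on_iff, rule_format, of z "f z - c"] assms(2,4) by auto
  have "max x (z - d) < min y (z + d)"
    using assms(2,3) d(1) by auto
  then obtain q :: rat where q: "max x (z - d) < of_rat q" "of_rat q < min y (z + d)"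
    using of_rat_dense by blast
  then have "dist (f (of_rat q)) (f z) < f z - c"
    by (intro d(2)) (auto simp: dist_real_def)
  with q that show ?thesis
    by (auto simp: dist_real_def)
qed

text \<open>The first maximizer lies after \<open>s\<close> exactly when the path exceeds, strictly
  between \<open>s\<close> and \<open>m\<close>, its maximum over \<open>[l, s]\<close>. Rational
  times and a rational separating level \<open>c\<close> make this a countable condition, ready for
  measurability. Testing \<open>f s\<close> separately covers \<open>l = s\<close>, when
  \<open>[l, s]\<close> may contain no rational.\<close>

lemma less_first_argmax_iff:
  fixes f :: "real \<Rightarrow> real"
  assumes cont: "continuous_on {l..m} f" and "l \<le> s" "l \<le> m"
  shows "s < first_argmax f l m \<longleftrightarrow>
    (\<exists>q::rat. s < of_rat q \<and> of_rat q < m \<and>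
      (\<exists>c::rat. of_rat c < f (of_rat q) \<and> f s \<le> of_rat c \<and>
        (\<forall>u::rat. l \<le> of_rat u \<and> of_rat u \<le> s \<longrightarrow> f (of_rat u) \<le> of_rat c)))"
    (is "_ \<longleftrightarrow> ?R")
proof
  let ?x = "first_argmax f l m"
  note x = first_argmax[OF cont \<open>l \<le> m\<close>]
  {
    assume s: "s < ?x"
    have "continuous_on {l..s} f"
      using x(1) s by (intro continuous_on_subset[OF cont]) auto
    then obtain w where w: "w \<in> {l..s}" "\<And>v. v \<in> {l..s} \<Longrightarrow> f v \<le> f w"
      using continuous_attains_sup[of "{l..s}" f] \<open>l \<le> s\<close> by auto
    have "f w < f ?x"
      using w(1) x(1) s by (intro x(3)) auto
    then obtain c :: rat where c: "f w < of_rat c" "of_rat c < f ?x"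
      using of_rat_dense by blast
    have "continuous_on {s..?x} f"
      using x(1) \<open>l \<le> s\<close> by (intro continuous_on_subset[OF cont]) auto
    \<comment> \<open>Approaching \<open>?x\<close> from the left keeps \<open>q\<close> strictly
      below \<open>m\<close>, even if \<open>?x = m\<close>.\<close>
    then obtain q :: rat where q: "s < of_rat q" "of_rat q < ?x" "of_rat c < f (of_rat q)"
      using continuous_on_greater_at_rat[of s ?x f ?x "of_rat c"] s c(2) by auto
    have "f v \<le> of_rat c" if "v \<in> {l..s}" for v
      using w(2)[OF that] c(1) by linarith
    with q x(1) \<open>l \<le> s\<close> show ?R
      by (intro exI[of _ q] conjI exI[of _ c] allI impI) auto
  next
    assume ?R
    then obtain q c :: rat where q: "s < of_rat q" "of_rat q < m" "of_rat c < f (of_rat q)"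
      and c: "f s \<le> of_rat c" "\<And>u::rat. l \<le> of_rat u \<Longrightarrow> of_rat u \<le> s \<Longrightarrow> f (of_rat u) \<le> of_rat c"
      by blast
    have fx: "of_rat c < f ?x"
      using x(2)[of "of_rat q"] q \<open>l \<le> s\<close> by auto
    show "s < ?x"
    proof (rule ccontr)
      assume "\<not> s < ?x"
      with fx c(1) have less: "?x < s"
        by (cases "?x = s") auto
      \<comment> \<open>By continuity at \<open>?x\<close>, the level \<open>c\<close> is also
        exceeded at a rational in \<open>(?x, s)\<close>, where it was assumed to be an upper
        bound.\<close>
      have "continuous_on {?x..s} f"
        using x(1) q by (intro continuous_on_subset[OF cont]) auto
      then obtain u :: rat where "?x < of_rat u" "of_rat u < s" "of_rat c < f (of_rat u)"
        using continuous_on_greater_at_rat[of ?x s f ?x "of_rat c"] less fx by auto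
      with c(2)[of u] x(1) show False
        by auto
    qed
  }
qed

text \<open>With \<open>s = t - a\<close>, on the event \<open>\<tau> \<le> t\<close> the window
  starts no later than \<open>s\<close>, so \<open>less_first_argmax_iff\<close> applies at
  \<open>s\<close> and looks at the path only up to time \<open>t\<close>. The random window ends
  enter only through events comparing \<open>\<tau>\<close> with rational thresholds.\<close>

lemma stopping_time_first_argmax_window:
  fixes F :: "real \<Rightarrow> 'a measure" and X :: "real \<Rightarrow> 'a \<Rightarrow> real"
  assumes "filtration \<Omega> F"
    and adapted: "\<And>s t. 0 \<le> s \<Longrightarrow> s \<le> t \<Longrightarrow> X s \<in> borel_measurable (F t)"
    and cont: "\<And>\<omega>. \<omega> \<in> \<Omega> \<Longrightarrow> continuous_on {0..} (\<lambda>u. X u \<omega>)"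
    and \<tau>: "stopping_time F \<tau>" "\<And>\<omega>. \<omega> \<in> \<Omega> \<Longrightarrow> 0 \<le> \<tau> \<omega>" and "0 \<le> a"
  shows "stopping_time F (\<lambda>\<omega>. first_argmax (\<lambda>u. X u \<omega>) (max 0 (\<tau> \<omega> - a)) (\<tau> \<omega>) + a)"
    (is "stopping_time F (\<lambda>\<omega>. ?\<sigma> \<omega> + a)")
proof
  interpret filtration \<Omega> F by fact
  fix t
  have cont': "continuous_on {max 0 (\<tau> \<omega> - a)..\<tau> \<omega>} (\<lambda>u. X u \<omega>)" if "\<omega> \<in> \<Omega>" for \<omega>
    by (rule continuous_on_subset[OF cont[OF that]]) auto
  have le: "max 0 (\<tau> \<omega> - a) \<le> \<tau> \<omega>" if "\<omega> \<in> \<Omega>" for \<omega>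
    using \<tau>(2)[OF that] \<open>0 \<le> a\<close> by auto
  have bnd: "0 \<le> ?\<sigma> \<omega>" "\<tau> \<omega> \<le> ?\<sigma> \<omega> + a" if "\<omega> \<in> \<Omega>" for \<omega>
    using first_argmax(1)[OF cont'[OF that] le[OF that]] by auto
  show "Measurable.pred (F t) (\<lambda>\<omega>. ?\<sigma> \<omega> + a \<le> t)"
  proof (cases "a \<le> t")
    case False
    then have "\<not> ?\<sigma> \<omega> + a \<le> t" if "\<omega> \<in> \<Omega>" for \<omega>
      using bnd(1)[OF that] by auto
    then have "Measurable.pred (F t) (\<lambda>\<omega>. ?\<sigma> \<omega> + a \<le> t) \<longleftrightarrow> Measurable.pred (F t) (\<lambda>\<omega>. False)"
      by (intro measurable_cong) (auto simp: space_F)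
    then show ?thesis by simp
  next
    case True
    define s where "s = t - a"
    have s: "0 \<le> s" "s \<le> t"
      using True \<open>0 \<le> a\<close> by (auto simp: s_def)
    \<comment> \<open>Here \<open>q < m\<close> becomes
      \<open>\<not> \<tau> \<omega> \<le> of_rat q\<close>, and \<open>l \<le> u\<close> becomes
      \<open>0 \<le> u\<close> together with \<open>\<tau> \<omega> \<le> u + a\<close>. The bounds
      \<open>q < t\<close> and \<open>u + a \<le> s + a = t\<close> place all these events in
      \<open>F t\<close>; the first is automatic when \<open>\<tau> \<le> t\<close>.\<close>
    let ?R = "\<lambda>\<omega>. \<exists>q\<in>{q::rat. s < of_rat q \<and> of_rat q < t}. \<not> \<tau> \<omega> \<le> of_rat q \<and>
      (\<exists>c::rat. of_rat c < X (of_rat q) \<omega> \<and> X s \<omega> \<le> of_rat c \<and>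
        (\<forall>u\<in>{u::rat. 0 \<le> (of_rat u :: real) \<and> of_rat u \<le> s}. \<tau> \<omega> \<le> of_rat u + a \<longrightarrow> X (of_rat u) \<omega> \<le> of_rat c))"
    have "?\<sigma> \<omega> + a \<le> t \<longleftrightarrow> \<tau> \<omega> \<le> t \<and> \<not> ?R \<omega>" if "\<omega> \<in> \<Omega>" for \<omega>
    proof (cases "\<tau> \<omega> \<le> t")
      case \<tau>t: True
      then have "max 0 (\<tau> \<omega> - a) \<le> s"
        using s by (auto simp: s_def)
      from less_first_argmax_iff[OF cont'[OF that] this le[OF that]]
      have "s < ?\<sigma> \<omega> \<longleftrightarrow> ?R \<omega>"
        using \<tau>t by (fastforce simp: not_le diff_le_eq)
      with \<tau>t show ?thesis
        by (auto simp: s_def)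
    next
      case False
      \<comment> \<open>If \<open>\<tau> > t\<close>, both sides are false, since
        \<open>?\<sigma> + a \<ge> \<tau>\<close>.\<close>
      with bnd(2)[OF that] show ?thesis by auto
    qed
    then have "Measurable.pred (F t) (\<lambda>\<omega>. ?\<sigma> \<omega> + a \<le> t) \<longleftrightarrow>
        Measurable.pred (F t) (\<lambda>\<omega>. \<tau> \<omega> \<le> t \<and> \<not> ?R \<omega>)"
      by (intro measurable_cong) (auto simp: space_F)
    also have "\<dots>"
    proof -
      have X: "X v \<in> borel_measurable (F t)" if "0 \<le> v" "v \<le> t" for v
        using that by (rule adapted)
      have "Measurable.pred (F t) (\<lambda>\<omega>. c < X v \<omega>)" "Measurable.pred (F t) (\<lambda>\<omega>. X v \<omega> \<le> c)"
        if "0 \<le> v" "v \<le> t" for v c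
        using X[OF that] by measurable
      then show ?thesis
        using s
        by (intro pred_intros_logic pred_intros_countable pred_intros_countable_bounded
            stopping_time_le_const[OF \<tau>(1)]) (auto simp: s_def simp del: zero_le_of_rat_iff)
    qed
    finally show ?thesis .
  qed
qed

section \<open>Wiener paths and the stock price along a path\<close>

lemma wiener_measureD:
  assumes "wiener_measure P"
  shows "space P = space path_space" "AE \<omega> in P. \<omega> 0 = 0"
    and "\<And>\<omega>. \<omega> \<in> space P \<Longrightarrow> continuous_on {0..} \<omega>"
  using assms
  by (auto simp: wiener_measure_def standard_brownian_motion_def dest: sets_eq_imp_space_eq)

lemma measurable_coordinate_augmented_filtration:
  assumes P: "wiener_measure P" and s: "0 \<le> s" "s \<le> t"
  shows "(\<lambda>\<omega>. \<omega> s) \<in> borel_measurable (augmented_filtration P t)"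
proof (rule measurableI)
  have sp: "space (augmented_filtration P t) = space path_space"
    using filtration.space_F[OF filtration_augmented[OF P]] wiener_measureD(1)[OF P] by simp
  fix A :: "real set" assume A: "A \<in> sets borel"
  \<comment> \<open>The event is observed at every \<open>r > t\<close>, so it survives the
    right-limit intersection.\<close>
  have "(\<lambda>\<omega>. \<omega> s) -` A \<inter> space path_space \<in> sets (canonical_filtration r)" if "t < r" for r
    unfolding canonical_filtration_def using A s that
    by (intro in_measure_of) force+
  then show "(\<lambda>\<omega>. \<omega> s) -` A \<inter> space (augmented_filtration P t) \<in> sets (augmented_filtration P t)"
    unfolding sets_augmented_filtration[OF P] sp by (auto intro: sigma_sets.Basic)
qed simp

lemma stock_price_nonneg_time:
  "0 \<le> u \<Longrightarrow> u \<le> T \<Longrightarrow> stock_price T u \<omega> = exp (\<omega> u - u / 2)"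
  by (simp add: stock_price_def)

text \<open>The price is constant before 0 and after \<open>T\<close>, and continuous on the compact
  interval between. Boundedness gives the real supremum in \<open>window_sup\<close> its intended
  meaning.\<close>

lemma bdd_above_stock_price:
  assumes "continuous_on {0..} \<omega>"
  shows "bdd_above ((\<lambda>u. stock_price T u \<omega>) ` A)"
proof -
  have "compact ((\<lambda>u. exp (\<omega> u - u / 2)) ` {0..T})"
    by (intro compact_continuous_image continuous_intros continuous_on_subset[OF assms]) auto
  then have "bdd_above ((\<lambda>u. exp (\<omega> u - u / 2)) ` {0..T})"
    by (intro bounded_imp_bdd_above compact_imp_bounded)
  then obtain B where B: "\<forall>u\<in>{0..T}. exp (\<omega> u - u / 2) \<le> B"
    unfolding bdd_above_def by auto
  show ?thesis
    using B by (intro bdd_aboveI2[of _ _ "max 1 (max B (exp (\<omega> T - T / 2)))"])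
      (auto simp: stock_price_def le_max_iff_disj)
qed

lemma stock_price_le_window_sup:
  assumes "continuous_on {0..} \<omega>" "u \<in> {t - a..t}"
  shows "stock_price T u \<omega> \<le> window_sup T a t \<omega>"
  unfolding window_sup_def using assms(2) by (rule cSUP_upper) (rule bdd_above_stock_price[OF assms(1)])

text \<open>Since \<open>exp\<close> is increasing, maximizing the exponent maximizes the price at
  nonnegative times.\<close>

lemma window_sup_le_stock_price_first_argmax:
  assumes cont: "continuous_on {0..} \<omega>" and "\<omega> 0 = 0" "0 \<le> t" "t \<le> T" "0 \<le> a"
  shows "window_sup T a t \<omega> \<le>
    stock_price T (first_argmax (\<lambda>u. \<omega> u - u / 2) (max 0 (t - a)) t) \<omega>"
    (is "_ \<le> stock_price T ?\<sigma> \<omega>")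
proof -
  have "continuous_on {max 0 (t - a)..t} (\<lambda>u. \<omega> u - u / 2)"
    by (intro continuous_intros continuous_on_subset[OF cont]) auto
  note \<sigma> = first_argmax[OF this]
  have S: "stock_price T ?\<sigma> \<omega> = exp (\<omega> ?\<sigma> - ?\<sigma> / 2)"
    using \<sigma>(1) assms(3-5) by (intro stock_price_nonneg_time) auto
  show ?thesis
    unfolding window_sup_def S
  proof (rule cSUP_least)
    fix u assume u: "u \<in> {t - a..t}"
    show "stock_price T u \<omega> \<le> exp (\<omega> ?\<sigma> - ?\<sigma> / 2)"
    proof (cases "u < 0")
      \<comment> \<open>A window reaching below 0 also contains 0, where the price is 1 because
        \<open>\<omega> 0 = 0\<close>; so the value 1 at negative times is matched.\<close>
      case True
      with u \<sigma>(2)[of 0] assms show ?thesis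
        by (simp add: stock_price_def)
    next
      case False
      with u \<sigma>(2)[of u] assms show ?thesis
        by (simp add: stock_price_nonneg_time)
    qed
  qed (use \<open>0 \<le> a\<close> in auto)
qed

section \<open>Comparison of the two suprema\<close>

theorem proposition2:
  fixes P :: "(real \<Rightarrow> real) measure" and T a :: real
  assumes "wiener_measure P" and "0 < a" and "a < T"
  shows "insider_value P T a =
    (SUP \<tau>\<in>stopping_times_between P 0 T.
       \<integral>\<^sup>+ \<omega>. ennreal (window_sup T a (\<tau> \<omega>) \<omega>) \<partial>completion P)"
  unfolding insider_value_def
proof (intro antisym SUP_mono)
  note W = wiener_measureD[OF assms(1)]
  {
    fix \<tau> assume \<tau>: "\<tau> \<in> stopping_times_between P a (T + a)"
    let ?\<rho> = "\<lambda>\<omega>. min (\<tau> \<omega>) T"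
    have "?\<rho> \<in> stopping_times_between P 0 T"
      using \<tau> assms by (fastforce simp: stopping_times_between_def
          intro: stopping_time_min stopping_time_const)
    \<comment> \<open>If \<open>\<tau> > T\<close>, then \<open>T - a < \<tau> - a \<le> T\<close>,
      so \<open>\<tau> - a\<close> lies in the window ending at \<open>T\<close>.\<close>
    moreover have "stock_price T (\<tau> \<omega> - a) \<omega> \<le> window_sup T a (?\<rho> \<omega>) \<omega>" if "\<omega> \<in> space P" for \<omega>
      using \<tau> that assms(2)
      by (intro stock_price_le_window_sup W(3)) (auto simp: stopping_times_between_def)
    then have "(\<integral>\<^sup>+ \<omega>. ennreal (stock_price T (\<tau> \<omega> - a) \<omega>) \<partial>completion P) \<le>
        (\<integral>\<^sup>+ \<omega>. ennreal (window_sup T a (?\<rho> \<omega>) \<omega>) \<partial>completion P)"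
      by (intro nn_integral_mono ennreal_leI) auto
    ultimately show "\<exists>\<rho>\<in>stopping_times_between P 0 T.
        (\<integral>\<^sup>+ \<omega>. ennreal (stock_price T (\<tau> \<omega> - a) \<omega>) \<partial>completion P) \<le>
        (\<integral>\<^sup>+ \<omega>. ennreal (window_sup T a (\<rho> \<omega>) \<omega>) \<partial>completion P)"
      by - (rule bexI)
  next
    fix \<tau> assume "\<tau> \<in> stopping_times_between P 0 T"
    then have \<tau>: "stopping_time (augmented_filtration P) \<tau>"
      "\<And>\<omega>. \<omega> \<in> space P \<Longrightarrow> 0 \<le> \<tau> \<omega>" "\<And>\<omega>. \<omega> \<in> space P \<Longrightarrow> \<tau> \<omega> \<le> T"
      by (auto simp: stopping_times_between_def)
    let ?X = "\<lambda>u \<omega>. \<omega> u - u / 2"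
    let ?\<sigma> = "\<lambda>\<omega>. first_argmax (\<lambda>u. ?X u \<omega>) (max 0 (\<tau> \<omega> - a)) (\<tau> \<omega>)"
    let ?\<rho> = "\<lambda>\<omega>. ?\<sigma> \<omega> + a"
    have cont: "continuous_on {0..} (\<lambda>u. ?X u \<omega>)" if "\<omega> \<in> space P" for \<omega>
      by (intro continuous_intros W(3) that) auto
    have "stopping_time (augmented_filtration P) ?\<rho>"
      using assms(2) \<tau> cont
      by (intro stopping_time_first_argmax_window[OF filtration_augmented[OF assms(1)]]
          borel_measurable_diff measurable_coordinate_augmented_filtration[OF assms(1)]) auto
    moreover have "?\<sigma> \<omega> \<in> {max 0 (\<tau> \<omega> - a)..\<tau> \<omega>}" if "\<omega> \<in> space P" for \<omega>
      using \<tau>(2)[OF that] assms(2)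
      by (intro first_argmax(1) continuous_on_subset[OF cont[OF that]]) auto
    ultimately have "?\<rho> \<in> stopping_times_between P a (T + a)"
      using \<tau>(3) by (force simp: stopping_times_between_def)
    \<comment> \<open>The comparison holds on paths started at 0, which under \<open>P\<close> is an
      almost sure property.\<close>
    moreover have "AE \<omega> in completion P. window_sup T a (\<tau> \<omega>) \<omega> \<le> stock_price T (?\<rho> \<omega> - a) \<omega>"
    proof (rule AE_completion)
      show "AE \<omega> in P. window_sup T a (\<tau> \<omega>) \<omega> \<le> stock_price T (?\<rho> \<omega> - a) \<omega>"
        using W(2)
      proof (rule AE_mp[OF _ AE_I2], intro impI)
        fix \<omega> assume "\<omega> \<in> space P" "\<omega> 0 = 0"
        then show "window_sup T a (\<tau> \<omega>) \<omega> \<le> stock_price T (?\<rho> \<omega> - a) \<omega>"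
          using window_sup_le_stock_price_first_argmax[OF W(3), of \<omega> "\<tau> \<omega>" T a] \<tau> assms(2) by simp
      qed
    qed
    then have "(\<integral>\<^sup>+ \<omega>. ennreal (window_sup T a (\<tau> \<omega>) \<omega>) \<partial>completion P) \<le>
        (\<integral>\<^sup>+ \<omega>. ennreal (stock_price T (?\<rho> \<omega> - a) \<omega>) \<partial>completion P)"
      by (intro nn_integral_mono_AE) (auto intro: ennreal_leI)
    ultimately show "\<exists>\<rho>\<in>stopping_times_between P a (T + a).
        (\<integral>\<^sup>+ \<omega>. ennreal (window_sup T a (\<tau> \<omega>) \<omega>) \<partial>completion P) \<le>
        (\<integral>\<^sup>+ \<omega>. ennreal (stock_price T (\<rho> \<omega> - a) \<omega>) \<partial>completion P)"
      by - (rule bexI)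
  }
qed

end
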